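(* Let $A, B, C$ be semigroups, and let $P:B\to A$ and $P':B\to C$ be mappings such that $\mathcal{M}(A;B;P)/\theta_{\mathcal{M}(A;B;P)}\cong\mathcal{M}(C;B;P')$ (so that $A,B,C$ is a right regular triple). Suppose that $P$ is surjective. If $A$ is left reductive, then $C$ is also left reductive.
   Context: A semigroup is a nonempty set with an associative multiplication. For a semigroup $S$, a nonempty set $\Lambda$ and a mapping $P:\Lambda\to S$, let $\mathcal{M}(S;\Lambda;P)$ denote the semigroup on the set $S\times\Lambda$ with multiplication $(s,\lambda)(t,\mu)=(sP(\lambda)t,\mu)$. For a semigroup $S$, $\theta_S=\{(a,b)\in S\times S: xa=xb \text{ for all } x\in S\}$; this is a congruence on $S$. A triple $A,B,C$ of semigroups is called right regular if there exist mappings (not necessarily homomorphisms) $P:B\to A$ and $P':B\to C$ such that $\mathcal{M}(A;B;P)/\theta_{\mathcal{M}(A;B;P)}\cong\mathcal{M}(C;B;P')$ as semigroups. A semigroup $S$ is left reductive if $\theta_S$ is the identity relation on $S$. *)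

theory Defs
  imports "HOL-Algebra.Group"
begin

text \<open>
  A semigroup is carried by the HOL-Algebra record type of monoids, so that the library's
  isomorphism relation \<^const>\<open>is_iso\<close> applies; that relation only refers to the fields
  \<^const>\<open>carrier\<close> and \<^const>\<open>mult\<close>. The field \<^const>\<open>one\<close> carries no information here:
  nothing is assumed about it, and it is left unspecified in the constructions below.
\<close>

locale carrier_semigroup =
  fixes S (structure)
  assumes nonempty: "carrier S \<noteq> {}"
    and closed: "\<lbrakk>x \<in> carrier S; y \<in> carrier S\<rbrakk> \<Longrightarrow> x \<otimes> y \<in> carrier S"
    and assoc: "\<lbrakk>x \<in> carrier S; y \<in> carrier S; z \<in> carrier S\<rbrakk>
          \<Longrightarrow> (x \<otimes> y) \<otimes> z = x \<otimes> (y \<otimes> z)"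

definition sandwich ::
    "('a, 'm) monoid_scheme \<Rightarrow> 'l set \<Rightarrow> ('l \<Rightarrow> 'a) \<Rightarrow> ('a \<times> 'l) monoid"
  where "sandwich S \<Lambda> P =
    \<lparr>carrier = carrier S \<times> \<Lambda>,
     mult = (\<lambda>(s, l) (t, m). (s \<otimes>\<^bsub>S\<^esub> P l \<otimes>\<^bsub>S\<^esub> t, m)),
     one = undefined\<rparr>"

definition theta :: "('a, 'm) monoid_scheme \<Rightarrow> ('a \<times> 'a) set"
  where "theta S = {(a, b). a \<in> carrier S \<and> b \<in> carrier S \<and>
    (\<forall>x \<in> carrier S. x \<otimes>\<^bsub>S\<^esub> a = x \<otimes>\<^bsub>S\<^esub> b)}"

definition left_reductive :: "('a, 'm) monoid_scheme \<Rightarrow> bool"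
  where "left_reductive S \<longleftrightarrow> theta S = Id_on (carrier S)"

text \<open>
  The product of two classes is the union of the classes of all products of representatives;
  for a congruence this is the class of any one such product (see \<open>quotient_mult\<close>).
\<close>

definition quotient_semigroup ::
    "('a, 'm) monoid_scheme \<Rightarrow> ('a \<times> 'a) set \<Rightarrow> 'a set monoid"
  where "quotient_semigroup S r =
    \<lparr>carrier = carrier S // r,
     mult = (\<lambda>X Y. \<Union>x \<in> X. \<Union>y \<in> Y. r `` {x \<otimes>\<^bsub>S\<^esub> y}),
     one = undefined\<rparr>"

lemma quotient_mult:
  assumes "equiv (carrier S) r"
    and "(\<lambda>x y. r `` {x \<otimes>\<^bsub>S\<^esub> y}) respects2 r"
    and "a \<in> carrier S" and "b \<in> carrier S"
  shows "r `` {a} \<otimes>\<^bsub>quotient_semigroup S r\<^esub> r `` {b} = r `` {a \<otimes>\<^bsub>S\<^esub> b}"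
  using UN_equiv_class2[OF assms(1,1,2,3,4)] by (simp add: quotient_semigroup_def)

lemma equiv_theta: "equiv (carrier S) (theta S)"
  by (auto simp: theta_def intro!: equivI refl_onI symI transI)

lemma (in carrier_semigroup) theta_congruence:
  "(\<lambda>x y. theta S `` {x \<otimes> y}) respects2 theta S"
proof (rule congruent2I')
  fix a a' b b'
  assume a: "(a, a') \<in> theta S" and b: "(b, b') \<in> theta S"
  have mem: "a \<in> carrier S" "a' \<in> carrier S" "b \<in> carrier S" "b' \<in> carrier S"
    and eq: "\<And>x. x \<in> carrier S \<Longrightarrow> x \<otimes> a = x \<otimes> a'" "\<And>x. x \<in> carrier S \<Longrightarrow> x \<otimes> b = x \<otimes> b'"
    using a b by (auto simp: theta_def)
  have "x \<otimes> (a \<otimes> b) = x \<otimes> (a' \<otimes> b')" if x: "x \<in> carrier S" for x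
    by (metis mem eq x assoc closed)
  then have "(a \<otimes> b, a' \<otimes> b') \<in> theta S"
    using mem by (simp add: theta_def closed)
  then show "theta S `` {a \<otimes> b} = theta S `` {a' \<otimes> b'}"
    by (rule equiv_class_eq[OF equiv_theta])
qed

lemma (in carrier_semigroup) sandwich_semigroup:
  assumes "\<Lambda> \<noteq> {}" and "P \<in> \<Lambda> \<rightarrow> carrier S"
  shows "carrier_semigroup (sandwich S \<Lambda> P)"
proof
  show "carrier (sandwich S \<Lambda> P) \<noteq> {}"
    using assms nonempty by (simp add: sandwich_def)
qed (use assms in \<open>auto simp: sandwich_def closed assoc Pi_iff\<close>)

end

theory Submission
  imports Defs
begin

text \<open>
  Surjectivity of \<open>P\<close> turns \<open>\<theta>\<close>-equivalence of \<open>(a, l)\<close> and \<open>(b, l)\<close> in the sandwich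
  semigroup over \<open>A\<close> into \<open>s t a = s t b\<close> for all \<open>s\<close>, \<open>t\<close>, and two applications of left
  reductivity give \<open>a = b\<close>. Hence this semigroup is left reductive and equals its quotient,
  so the sandwich semigroup over \<open>C\<close> is left reductive. If \<open>x c = x d\<close> for all \<open>x\<close> in \<open>C\<close>,
  then \<open>(c, l)\<close> and \<open>(d, l)\<close> are \<open>\<theta>\<close>-equivalent there, so \<open>c = d\<close>.
\<close>

lemma left_reductive_iff:
  "left_reductive S \<longleftrightarrow>
    (\<forall>a \<in> carrier S. \<forall>b \<in> carrier S.
      (\<forall>x \<in> carrier S. x \<otimes>\<^bsub>S\<^esub> a = x \<otimes>\<^bsub>S\<^esub> b) \<longrightarrow> a = b)"
  unfolding left_reductive_def theta_def Id_on_def by auto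

lemma left_reductiveD:
  assumes "left_reductive S" and "a \<in> carrier S" and "b \<in> carrier S"
    and "\<And>x. x \<in> carrier S \<Longrightarrow> x \<otimes>\<^bsub>S\<^esub> a = x \<otimes>\<^bsub>S\<^esub> b"
  shows "a = b"
  using assms unfolding left_reductive_iff by blast

lemma left_reductiveI:
  assumes "\<And>a b. \<lbrakk>a \<in> carrier S; b \<in> carrier S;
      \<And>x. x \<in> carrier S \<Longrightarrow> x \<otimes>\<^bsub>S\<^esub> a = x \<otimes>\<^bsub>S\<^esub> b\<rbrakk> \<Longrightarrow> a = b"
  shows "left_reductive S"
  using assms unfolding left_reductive_iff by blast

lemma carrier_sandwich: "carrier (sandwich S \<Lambda> P) = carrier S \<times> \<Lambda>"
  by (simp add: sandwich_def)

lemma mult_sandwich: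
  "(s, l) \<otimes>\<^bsub>sandwich S \<Lambda> P\<^esub> (t, m) = (s \<otimes>\<^bsub>S\<^esub> P l \<otimes>\<^bsub>S\<^esub> t, m)"
  by (simp add: sandwich_def)

lemma (in carrier_semigroup) left_reductive_sandwich:
  assumes P: "P ` \<Lambda> = carrier S" and S: "left_reductive S"
  shows "left_reductive (sandwich S \<Lambda> P)"
proof (rule left_reductiveI)
  fix u v
  assume "u \<in> carrier (sandwich S \<Lambda> P)" and "v \<in> carrier (sandwich S \<Lambda> P)"
  then obtain a l b m where u: "u = (a, l)" "a \<in> carrier S" "l \<in> \<Lambda>"
    and v: "v = (b, m)" "b \<in> carrier S" "m \<in> \<Lambda>"
    by (auto simp: carrier_sandwich)
  assume eq: "\<And>x. x \<in> carrier (sandwich S \<Lambda> P) \<Longrightarrow>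
      x \<otimes>\<^bsub>sandwich S \<Lambda> P\<^esub> u = x \<otimes>\<^bsub>sandwich S \<Lambda> P\<^esub> v"
  \<comment> \<open>Left multiplication by \<open>(s, k)\<close> keeps the right index, so the
    second coordinates of the two products are \<open>l\<close> and \<open>m\<close>
    themselves.\<close>
  have prod: "s \<otimes> P k \<otimes> a = s \<otimes> P k \<otimes> b" "l = m" if "s \<in> carrier S" "k \<in> \<Lambda>" for s k
    using eq[of "(s, k)"] that u v by (simp_all add: carrier_sandwich mult_sandwich)
  \<comment> \<open>Some multiplier \<open>(s, k)\<close> must exist: nonemptiness of the semigroup
    supplies \<open>s\<close>, and \<open>l\<close> serves as \<open>k\<close>.\<close>
  have "l = m"
    using nonempty u(3) prod(2) by blast
  moreover have "a = b"
  proof (rule left_reductiveD[OF S u(2) v(2)])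
    fix t assume t: "t \<in> carrier S"
    \<comment> \<open>Surjectivity of \<open>P\<close> enters here: the middle factor
      \<open>P k\<close> can be any prescribed \<open>t\<close>.\<close>
    then obtain k where k: "k \<in> \<Lambda>" "t = P k"
      using P by blast
    \<comment> \<open>The inner use of left reductivity cancels \<open>s\<close>; the outer one then
      cancels \<open>t\<close>.\<close>
    show "t \<otimes> a = t \<otimes> b"
    proof (rule left_reductiveD[OF S])
      fix s assume "s \<in> carrier S"
      then show "s \<otimes> (t \<otimes> a) = s \<otimes> (t \<otimes> b)"
        using prod(1)[of s k] k t u(2) v(2) by (simp add: assoc)
    qed (use t u(2) v(2) closed in auto)
  qed
  ultimately show "u = v"
    using u v by simp
qed

lemma (in carrier_semigroup) left_reductive_of_sandwich:
  assumes "\<Lambda> \<noteq> {}" and P: "P \<in> \<Lambda> \<rightarrow> carrier S"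
    and red: "left_reductive (sandwich S \<Lambda> P)"
  shows "left_reductive S"
proof (rule left_reductiveI)
  fix c d
  assume c: "c \<in> carrier S" and d: "d \<in> carrier S"
    and eq: "\<And>x. x \<in> carrier S \<Longrightarrow> x \<otimes> c = x \<otimes> d"
  obtain l where l: "l \<in> \<Lambda>"
    using assms(1) by blast
  \<comment> \<open>A multiplier \<open>(x, k)\<close> gives first coordinates
    \<open>x \<otimes> P k \<otimes> c\<close> and \<open>x \<otimes> P k \<otimes> d\<close>, which
    agree by \<open>eq\<close> at \<open>x \<otimes> P k\<close>. The second coordinates agree
    because both pairs have index \<open>l\<close>.\<close>
  have "(c, l) = (d, l)"
    by (rule left_reductiveD[OF red])
      (use c d l P eq closed in \<open>auto simp: carrier_sandwich mult_sandwich Pi_iff\<close>)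
  then show "c = d"
    by simp
qed

lemma left_reductive_iso:
  assumes "left_reductive S" and "carrier_semigroup S" and "S \<cong> T"
  shows "left_reductive T"
proof -
  obtain h where hom: "h \<in> hom S T" and bij: "bij_betw h (carrier S) (carrier T)"
    using assms(3) by (auto simp: is_iso_def iso_def)
  show ?thesis
  proof (rule left_reductiveI)
    fix c d
    assume "c \<in> carrier T" and "d \<in> carrier T"
    then obtain a b where a: "a \<in> carrier S" "c = h a" and b: "b \<in> carrier S" "d = h b"
      using bij_betw_imp_surj_on[OF bij] by blast
    assume eq: "\<And>x. x \<in> carrier T \<Longrightarrow> x \<otimes>\<^bsub>T\<^esub> c = x \<otimes>\<^bsub>T\<^esub> d"
    have "a = b"
    proof (rule left_reductiveD[OF assms(1) a(1) b(1)])
      fix x assume x: "x \<in> carrier S"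
      have "h (x \<otimes>\<^bsub>S\<^esub> a) = h (x \<otimes>\<^bsub>S\<^esub> b)"
        using eq[of "h x"] x a b hom by (simp add: hom_mult hom_in_carrier)
      then show "x \<otimes>\<^bsub>S\<^esub> a = x \<otimes>\<^bsub>S\<^esub> b"
        \<comment> \<open>The map \<open>h\<close> is injective only on the carrier, so closure must
          place both products there.\<close>
        using bij x a(1) b(1) carrier_semigroup.closed[OF assms(2)]
        by (meson bij_betw_def inj_onD)
    qed
    then show "c = d"
      using a b by simp
  qed
qed

text \<open>When \<open>theta S\<close> is the identity on the carrier, its classes are singletons,
  so the canonical projection is injective.\<close>

lemma quotient_theta_iso:
  assumes "left_reductive S" and "carrier_semigroup S"
  shows "S \<cong> quotient_semigroup S (theta S)"
proof -
  let ?Q = "quotient_semigroup S (theta S)" and ?h = "\<lambda>x. theta S `` {x}"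
  have "?h \<in> hom S ?Q"
    using quotient_mult[OF equiv_theta carrier_semigroup.theta_congruence[OF assms(2)]]
    by (auto intro!: homI quotientI simp: quotient_semigroup_def)
  moreover have "inj_on ?h (carrier S)"
    using assms(1) by (auto simp: left_reductive_def inj_on_def)
  moreover have "?h ` carrier S = carrier ?Q"
    by (auto simp: quotient_semigroup_def quotient_def)
  ultimately show ?thesis
    by (auto simp: is_iso_def iso_def bij_betw_def)
qed

theorem theorem6:
  fixes A :: "('a, 'm) monoid_scheme"
    and B :: "('b, 'n) monoid_scheme"
    and C :: "('c, 'k) monoid_scheme"
    and P :: "'b \<Rightarrow> 'a" and P' :: "'b \<Rightarrow> 'c"
  assumes "carrier_semigroup A" and "carrier_semigroup B" and "carrier_semigroup C"
    and "P \<in> carrier B \<rightarrow> carrier A" and "P' \<in> carrier B \<rightarrow> carrier C"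
    and "quotient_semigroup (sandwich A (carrier B) P) (theta (sandwich A (carrier B) P))
           \<cong> sandwich C (carrier B) P'"
    and "P ` carrier B = carrier A"
    and "left_reductive A"
  shows "left_reductive C"
proof -
  let ?M = "sandwich A (carrier B) P"
  have "left_reductive ?M"
    by (rule carrier_semigroup.left_reductive_sandwich[OF assms(1,7,8)])
  moreover have "carrier_semigroup ?M"
    using assms(1,2,4)
    by (intro carrier_semigroup.sandwich_semigroup carrier_semigroup.nonempty)
  ultimately have "left_reductive (sandwich C (carrier B) P')"
    \<comment> \<open>Left reductivity travels along the composite of the projection of
      \<open>?M\<close> onto its quotient and the given isomorphism.\<close>
    by (intro left_reductive_iso[OF _ _ iso_trans[OF quotient_theta_iso assms(6)]])
  then show ?thesis
    by (rule carrier_semigroup.left_reductive_of_sandwich[OF assms(3)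
          carrier_semigroup.nonempty[OF assms(2)] assms(5)])
qed

end
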